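(* Let $n\ge 1$, let $\theta_1,\dots,\theta_n>0$ be pairwise distinct, and let $S_n\sim\mathrm{HypoXG}(\theta_1,\dots,\theta_n)$. Then the cumulative distribution function of $S_n$ satisfies $$F_{S_n}(t)=\sum_{i=1}^{n}\sum_{k=1}^{3}R_{ik}\,F_{Y_{ik}}(t),$$ where $F_{Y_{ik}}$ is the cumulative distribution function of $Y_{ik}\sim\mathrm{Erl}(4-k,\theta_i)$ and the $R_{ik}$ are the HypoXG coefficients associated with $(\theta_1,\dots,\theta_n)$.
   Context: XGamma distribution: for $\theta>0$, $X\sim \mathrm{XG}(\theta)$ means $X$ is a real random variable with density $\frac{\theta^2}{1+\theta}\left(1+\frac{\theta}{2}t^2\right)e^{-\theta t}$ for $t>0$, and $0$ otherwise. HypoXG: $S_n\sim\mathrm{HypoXG}(\theta_1,\dots,\theta_n)$ means $S_n=X_1+\cdots+X_n$ with $X_1,\dots,X_n$ independent and $X_j\sim\mathrm{XG}(\theta_j)$. Erlang distribution: for an integer $m\ge 1$ and $\theta>0$, $Y\sim\mathrm{Erl}(m,\theta)$ means $Y$ has density $\frac{(\theta t)^{m-1}\theta e^{-\theta t}}{(m-1)!}$ for $t\ge 0$ and $0$ for $t<0$. HypoXG coefficients: for pairwise distinct $\theta_1,\dots,\theta_n>0$, $1\le i\le n$, $1\le k\le 3$, $$R_{ik}=\frac{A_{ik}}{\theta_i^{4-k}}\prod_{l=1}^{n}\frac{\theta_l^{2}}{1+\theta_l},$$ where $$A_{i1}=\theta_i\prod_{j\ne i}\frac{(\theta_j-\theta_i)^2+\theta_j}{(\theta_j-\theta_i)^3},\qquad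 A_{i2}=A_{i1}\sum_{j\neq i}\left(\frac{2(\theta_j-\theta_i)}{(\theta_j-\theta_i)^2+\theta_j}-\frac{3}{\theta_j-\theta_i}\right),$$ $$A_{i3}=\frac{A_{i1}}{2}\left(\sum_{j\ne i}\left(\frac{2(\theta_j-\theta_i)}{(\theta_j-\theta_i)^2+\theta_j}-\frac{3}{\theta_j-\theta_i}\right)\right)^{2}+\frac{A_{i1}}{2}\left(\frac{2}{\theta_i}+\sum_{j\ne i}\left(-2\,\frac{(\theta_j-\theta_i)^2-\theta_j}{\left((\theta_j-\theta_i)^2+\theta_j\right)^2}+\frac{3}{(\theta_j-\theta_i)^2}\right)\right),$$ products and sums being over $j\in\{1,\dots,n\}\setminus\{i\}$ (empty product $=1$, empty sum $=0$). *)

theory Defs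
  imports "HOL-Probability.Probability"
begin

definition xgamma_density :: "real \<Rightarrow> real \<Rightarrow> real" where
  "xgamma_density \<theta> t =
     (if 0 < t then \<theta>\<^sup>2 / (1 + \<theta>) * (1 + \<theta> / 2 * t\<^sup>2) * exp (- \<theta> * t) else 0)"

definition XG_distributed :: "'a measure \<Rightarrow> ('a \<Rightarrow> real) \<Rightarrow> real \<Rightarrow> bool" where
  "XG_distributed M X \<theta> \<longleftrightarrow> 0 < \<theta> \<and> distributed M lborel X (xgamma_density \<theta>)"

text \<open>The shape parameter of \<^const>\<open>erlang_density\<close> is the power of \<open>t\<close>,
  that is, one less than the conventional shape \<open>m\<close>.\<close>

definition Erl_distributed :: "'a measure \<Rightarrow> ('a \<Rightarrow> real) \<Rightarrow> nat \<Rightarrow> real \<Rightarrow> bool" where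
  "Erl_distributed M Y m \<theta> \<longleftrightarrow>
     1 \<le> m \<and> 0 < \<theta> \<and> distributed M lborel Y (erlang_density (m - 1) \<theta>)"

definition HypoXG_distributed ::
    "'a measure \<Rightarrow> ('a \<Rightarrow> real) \<Rightarrow> nat \<Rightarrow> (nat \<Rightarrow> real) \<Rightarrow> bool" where
  "HypoXG_distributed M S n \<theta> \<longleftrightarrow>
     (\<exists>X :: nat \<Rightarrow> 'a \<Rightarrow> real.
        prob_space.indep_vars M (\<lambda>_. borel) X {1..n} \<and>
        (\<forall>j\<in>{1..n}. XG_distributed M (X j) (\<theta> j)) \<and>
        (\<forall>\<omega>\<in>space M. S \<omega> = (\<Sum>j\<in>{1..n}. X j \<omega>)))"

definition hypoxg_A1 :: "nat \<Rightarrow> (nat \<Rightarrow> real) \<Rightarrow> nat \<Rightarrow> real" where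
  "hypoxg_A1 n \<theta> i =
     \<theta> i * (\<Prod>j\<in>{1..n} - {i}. ((\<theta> j - \<theta> i)\<^sup>2 + \<theta> j) / (\<theta> j - \<theta> i) ^ 3)"

definition hypoxg_A2 :: "nat \<Rightarrow> (nat \<Rightarrow> real) \<Rightarrow> nat \<Rightarrow> real" where
  "hypoxg_A2 n \<theta> i =
     hypoxg_A1 n \<theta> i *
       (\<Sum>j\<in>{1..n} - {i}.
          2 * (\<theta> j - \<theta> i) / ((\<theta> j - \<theta> i)\<^sup>2 + \<theta> j) - 3 / (\<theta> j - \<theta> i))"

definition hypoxg_A3 :: "nat \<Rightarrow> (nat \<Rightarrow> real) \<Rightarrow> nat \<Rightarrow> real" where
  "hypoxg_A3 n \<theta> i =
     hypoxg_A1 n \<theta> i / 2 *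
       (\<Sum>j\<in>{1..n} - {i}.
          2 * (\<theta> j - \<theta> i) / ((\<theta> j - \<theta> i)\<^sup>2 + \<theta> j) - 3 / (\<theta> j - \<theta> i))\<^sup>2
     + hypoxg_A1 n \<theta> i / 2 *
       (2 / \<theta> i +
        (\<Sum>j\<in>{1..n} - {i}.
           - 2 * (((\<theta> j - \<theta> i)\<^sup>2 - \<theta> j) / ((\<theta> j - \<theta> i)\<^sup>2 + \<theta> j)\<^sup>2)
           + 3 / (\<theta> j - \<theta> i)\<^sup>2))"

text \<open>Only the values at \<open>k = 1, 2, 3\<close> are meaningful.\<close>

definition hypoxg_A :: "nat \<Rightarrow> (nat \<Rightarrow> real) \<Rightarrow> nat \<Rightarrow> nat \<Rightarrow> real" where
  "hypoxg_A n \<theta> i k =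
     (if k = 1 then hypoxg_A1 n \<theta> i
      else if k = 2 then hypoxg_A2 n \<theta> i
      else hypoxg_A3 n \<theta> i)"

definition hypoxg_R :: "nat \<Rightarrow> (nat \<Rightarrow> real) \<Rightarrow> nat \<Rightarrow> nat \<Rightarrow> real" where
  "hypoxg_R n \<theta> i k =
     hypoxg_A n \<theta> i k / \<theta> i ^ (4 - k) * (\<Prod>l\<in>{1..n}. (\<theta> l)\<^sup>2 / (1 + \<theta> l))"

end

(* The characteristic function of XG(theta) is
   theta^2 / (1 + theta) * ((theta - iu)^2 + theta) / (theta - iu)^3, so that of the sum is a
   product of such factors. The coefficients A_ik are those of its partial fraction expansion in
   the triple poles theta_i: they are the second order Taylor coefficients at a pole of the
   remaining factors, computed through logarithmic derivatives. The terms of the expansion are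
   multiples of Erlang characteristic functions. Since the R_ik may be negative, uniqueness of
   characteristic functions does not apply to the right-hand side; instead, the inversion formula,
   which is linear in the characteristic function, carries the identity over to the
   distribution functions. *)

theory Submission imports Defs begin

section \<open>Second order Taylor expansions as congruences modulo a cube\<close>

text \<open>Divisibility of \<open>p - G * a\<close> by \<open>u ^ 3\<close> encodes
  \<open>p / a = G + O(u ^ 3)\<close> without dividing by \<open>a\<close>. Such expansions
  multiply, and \<open>H\<close> may be any truncation of \<open>G * g\<close> that agrees with it
  up to order two.\<close>

lemma cube_dvd_expansion:
  fixes u p q a b G g H :: "'a::comm_ring_1"
  assumes "u ^ 3 dvd p - G * a" and "u ^ 3 dvd q - g * b"
    and "u ^ 3 dvd G * g - H"
  shows "u ^ 3 dvd p * q - H * (a * b)"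
proof -
  have "p * q - H * (a * b) = (p - G * a) * q + G * a * (q - g * b) + (G * g - H) * (a * b)"
    by (simp add: algebra_simps)
  then show ?thesis using assms by (auto intro!: dvd_add)
qed

text \<open>The hypotheses equate the coefficients of \<open>1\<close>, \<open>u\<close> and
  \<open>u ^ 2\<close> in the numerator with those in
  \<open>G * (1 + L * u + Q * u ^ 2) * (u + D) ^ 3\<close>, so only terms of order three and more
  survive.\<close>

lemma quadratic_over_cube_expansion:
  fixes u D C G L Q :: "'a::comm_ring_1"
  assumes 0: "G * D ^ 3 = D\<^sup>2 + C"
    and 1: "G * (3 * D\<^sup>2 + L * D ^ 3) = 2 * D"
    and 2: "G * (3 * D + 3 * D\<^sup>2 * L + Q * D ^ 3) = 1"
  shows "u ^ 3 dvd ((u + D)\<^sup>2 + C) - G * (1 + L * u + Q * u\<^sup>2) * (u + D) ^ 3"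
proof -
  \<comment> \<open>The coefficients of \<open>u ^ 3\<close>, \<open>u ^ 4\<close> and
    \<open>u ^ 5\<close> in \<open>(1 + L * u + Q * u ^ 2) * (u + D) ^ 3\<close>, with
    \<open>u ^ 3\<close> factored out.\<close>
  let ?w = "1 + 3 * D * L + 3 * D\<^sup>2 * Q + (L + 3 * D * Q) * u + Q * u\<^sup>2"
  have "((u + D)\<^sup>2 + C) - G * (1 + L * u + Q * u\<^sup>2) * (u + D) ^ 3
      = (D\<^sup>2 + C - G * D ^ 3) + (2 * D - G * (3 * D\<^sup>2 + L * D ^ 3)) * u
        + (1 - G * (3 * D + 3 * D\<^sup>2 * L + Q * D ^ 3)) * u\<^sup>2 + u ^ 3 * (- G * ?w)"
    by (simp add: algebra_simps power2_eq_square power3_eq_cube)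
  also have "\<dots> = u ^ 3 * (- G * ?w)"
    using 0 1 2 by simp
  finally show ?thesis by simp
qed

text \<open>Taylor expansion to second order of the product of the functions
  \<open>((u + d)\<^sup>2 + c) / (u + d)\<^sup>3\<close> at \<open>u = 0\<close>, with denominators cleared: the value is
  \<open>G\<close>, and \<open>L\<close> and \<open>K\<close> are the first two derivatives of its logarithm.\<close>

lemma prod_quadratic_over_cube_expansion:
  fixes u :: "'a::field_char_0 poly" and c d :: "'i \<Rightarrow> 'a"
  assumes "finite J" and "\<And>j. j \<in> J \<Longrightarrow> d j \<noteq> 0" and "\<And>j. j \<in> J \<Longrightarrow> (d j)\<^sup>2 + c j \<noteq> 0"
  defines "G \<equiv> \<Prod>j\<in>J. ((d j)\<^sup>2 + c j) / d j ^ 3"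
    and "L \<equiv> \<Sum>j\<in>J. 2 * d j / ((d j)\<^sup>2 + c j) - 3 / d j"
    and "K \<equiv> \<Sum>j\<in>J. - 2 * (((d j)\<^sup>2 - c j) / ((d j)\<^sup>2 + c j)\<^sup>2) + 3 / (d j)\<^sup>2"
  shows "u ^ 3 dvd (\<Prod>j\<in>J. (u + [:d j:])\<^sup>2 + [:c j:])
    - [:G:] * (1 + [:L:] * u + [:(L\<^sup>2 + K) / 2:] * u\<^sup>2) * (\<Prod>j\<in>J. (u + [:d j:]) ^ 3)"
  using assms(1-3) unfolding G_def L_def K_def
proof (induction J rule: finite_induct)
  case empty
  then show ?case by (simp add: one_pCons[symmetric])
next
  case (insert x F)
  define g where "g = ((d x)\<^sup>2 + c x) / d x ^ 3"
  define l where "l = 2 * d x / ((d x)\<^sup>2 + c x) - 3 / d x"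
  define k where "k = - 2 * (((d x)\<^sup>2 - c x) / ((d x)\<^sup>2 + c x)\<^sup>2) + 3 / (d x)\<^sup>2"
  define G where "G = (\<Prod>j\<in>F. ((d j)\<^sup>2 + c j) / d j ^ 3)"
  define L where "L = (\<Sum>j\<in>F. 2 * d j / ((d j)\<^sup>2 + c j) - 3 / d j)"
  define K where "K = (\<Sum>j\<in>F. - 2 * (((d j)\<^sup>2 - c j) / ((d j)\<^sup>2 + c j)\<^sup>2) + 3 / (d j)\<^sup>2)"
  \<comment> \<open>Eliminating \<open>c x\<close> in favour of the numerator value \<open>e\<close>
    leaves only powers of the nonzero atoms \<open>y\<close> and \<open>e\<close> as
    denominators.\<close>
  define y where "y = d x"
  define e where "e = y\<^sup>2 + c x"
  have nz: "y \<noteq> 0" "e \<noteq> 0" using insert.prems by (auto simp: y_def e_def)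
  have c: "c x = e - y\<^sup>2" by (simp add: e_def)
  have g: "g = e / y ^ 3" and l: "l = 2 * y / e - 3 / y"
    and k: "k = - 2 * ((2 * y\<^sup>2 - e) / e\<^sup>2) + 3 / y\<^sup>2"
    by (simp_all add: g_def l_def k_def y_def e_def)
  \<comment> \<open>Coefficient comparison for the single new factor, whose expansion is
    \<open>g * exp (l * u + k * u ^ 2 / 2)\<close> up to order two; this is where the quadratic
    coefficient \<open>(l ^ 2 + k) / 2\<close> comes from.\<close>
  have f0: "g * y ^ 3 = y\<^sup>2 + c x" using nz by (simp add: g c)
  have f1: "g * (3 * y\<^sup>2 + l * y ^ 3) = 2 * y"
    using nz by (simp add: g l field_simps) (simp add: power2_eq_square power3_eq_cube algebra_simps)
  have f2: "g * (3 * y + 3 * y\<^sup>2 * l + (l\<^sup>2 + k) / 2 * y ^ 3) = 1"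
    using nz by (simp add: g l k field_simps power2_eq_square power3_eq_cube)
  have num: "(numeral n :: 'a poly) = [:numeral n:]" for n by (simp add: numeral_poly)
  have step: "u ^ 3 dvd ((u + [:y:])\<^sup>2 + [:c x:]) - [:g:] * (1 + [:l:] * u + [:(l\<^sup>2 + k) / 2:] * u\<^sup>2) * (u + [:y:]) ^ 3"
  proof (rule quadratic_over_cube_expansion)
    show "[:g:] * [:y:] ^ 3 = [:y:]\<^sup>2 + [:c x:]"
      using f0 by (simp add: poly_const_pow mult.commute)
    show "[:g:] * (3 * [:y:]\<^sup>2 + [:l:] * [:y:] ^ 3) = 2 * [:y:]"
      using f1 by (simp add: poly_const_pow num ac_simps)
    show "[:g:] * (3 * [:y:] + 3 * [:y:]\<^sup>2 * [:l:] + [:(l\<^sup>2 + k) / 2:] * [:y:] ^ 3) = 1"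
      using f2 by (simp add: poly_const_pow num one_pCons ac_simps)
  qed
  \<comment> \<open>Logarithmic derivatives add under multiplication: the cross term
    \<open>l * L\<close> completes the squares of \<open>l\<close> and \<open>L\<close> to that of
    \<open>l + L\<close>.\<close>
  have comb: "u ^ 3 dvd [:G:] * (1 + [:L:] * u + [:(L\<^sup>2 + K) / 2:] * u\<^sup>2) * ([:g:] * (1 + [:l:] * u + [:(l\<^sup>2 + k) / 2:] * u\<^sup>2))
     - [:g * G:] * (1 + [:l + L:] * u + [:((l + L)\<^sup>2 + (k + K)) / 2:] * u\<^sup>2)"
  proof -
    let ?Q = "[:(L\<^sup>2 + K) / 2:]" and ?q = "[:(l\<^sup>2 + k) / 2:]"
    have h: "[:((l + L)\<^sup>2 + (k + K)) / 2:] = ?Q + ?q + [:l:] * [:L:]"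
      by (simp add: field_simps power2_eq_square)
    have gG: "[:g * G:] = [:g:] * [:G:]" and lL: "[:l + L:] = [:l:] + [:L:]" by simp_all
    have "[:G:] * (1 + [:L:] * u + ?Q * u\<^sup>2) * ([:g:] * (1 + [:l:] * u + ?q * u\<^sup>2))
     - [:g * G:] * (1 + [:l + L:] * u + [:((l + L)\<^sup>2 + (k + K)) / 2:] * u\<^sup>2)
     = u ^ 3 * ([:G:] * [:g:] * ([:L:] * ?q + ?Q * [:l:] + ?Q * ?q * u))"
      unfolding h gG lL
      by (simp only: algebra_simps power2_eq_square power3_eq_cube mult_1_left mult_1_right)
    then show ?thesis by (metis dvd_triv_left)
  qed
  have IH: "u ^ 3 dvd (\<Prod>j\<in>F. (u + [:d j:])\<^sup>2 + [:c j:])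
    - [:G:] * (1 + [:L:] * u + [:(L\<^sup>2 + K) / 2:] * u\<^sup>2) * (\<Prod>j\<in>F. (u + [:d j:]) ^ 3)"
    unfolding G_def L_def K_def using insert by blast
  show ?case
    using cube_dvd_expansion[OF IH step comb] insert(1,2)
    unfolding prod.insert[OF insert(1,2)] sum.insert[OF insert(1,2)]
    by (simp only: G_def L_def K_def g_def l_def k_def y_def ac_simps)
qed

section \<open>Partial fractions with triple poles\<close>

text \<open>Each of the \<open>card I\<close> distinct points would be a root of order at least
  three, but the orders of the roots of a nonzero polynomial add up to at most its degree.\<close>

lemma poly_eq_0_if_cubes_dvd:
  fixes P :: "'a::field poly"
  assumes "finite I" and "inj_on a I" and "\<And>i. i \<in> I \<Longrightarrow> [:- a i, 1:] ^ 3 dvd P"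
    and "degree P < 3 * card I"
  shows "P = 0"
proof (rule ccontr)
  assume P: "P \<noteq> 0"
  have ord: "3 \<le> order (a i) P" if "i \<in> I" for i
    using assms(3)[OF that] P by (simp add: order_divides)
  then have sub: "a ` I \<subseteq> {x. poly P x = 0}"
    using P by (fastforce simp: order_root)
  have "3 * card I = (\<Sum>x\<in>a ` I. 3)"
    using assms(2) by (simp add: card_image)
  also have "\<dots> \<le> (\<Sum>x\<in>a ` I. order x P)"
    using ord by (intro sum_mono) auto
  also have "\<dots> \<le> (\<Sum>x | poly P x = 0. order x P)"
    using sub P by (intro sum_mono2) (auto simp: poly_roots_finite)
  also have "\<dots> \<le> degree P" by (rule sum_order_le_degree[OF P])
  finally show False using assms(4) by simp
qed

text \<open>With denominators cleared, the difference of the two sides is a polynomial of degree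
  below \<open>3 * card I\<close>. The coefficients at each pole match the Taylor expansion there,
  so the cube of every linear factor divides this difference and it vanishes.\<close>

lemma partial_fractions_triple_poles:
  fixes \<theta> :: "'i \<Rightarrow> 'a::field_char_0" and s :: 'a
  assumes I: "finite I" "I \<noteq> {}" and inj: "inj_on \<theta> I"
    and nz: "\<And>i. i \<in> I \<Longrightarrow> \<theta> i \<noteq> 0"
    and nz2: "\<And>i j. i \<in> I \<Longrightarrow> j \<in> I \<Longrightarrow> (\<theta> j - \<theta> i)\<^sup>2 + \<theta> j \<noteq> 0"
    and s: "\<And>i. i \<in> I \<Longrightarrow> s + \<theta> i \<noteq> 0"
  defines "G \<equiv> \<lambda>i. \<Prod>j\<in>I - {i}. ((\<theta> j - \<theta> i)\<^sup>2 + \<theta> j) / (\<theta> j - \<theta> i) ^ 3"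
    and "L \<equiv> \<lambda>i. \<Sum>j\<in>I - {i}. 2 * (\<theta> j - \<theta> i) / ((\<theta> j - \<theta> i)\<^sup>2 + \<theta> j) - 3 / (\<theta> j - \<theta> i)"
    and "K \<equiv> \<lambda>i. \<Sum>j\<in>I - {i}. - 2 * (((\<theta> j - \<theta> i)\<^sup>2 - \<theta> j) / ((\<theta> j - \<theta> i)\<^sup>2 + \<theta> j)\<^sup>2) + 3 / (\<theta> j - \<theta> i)\<^sup>2"
  shows "(\<Prod>j\<in>I. ((s + \<theta> j)\<^sup>2 + \<theta> j) / (s + \<theta> j) ^ 3) =
    (\<Sum>i\<in>I. \<theta> i * G i / (s + \<theta> i) ^ 3 + \<theta> i * G i * L i / (s + \<theta> i)\<^sup>2
      + (\<theta> i * G i / 2 * (L i)\<^sup>2 + \<theta> i * G i / 2 * (2 / \<theta> i + K i)) / (s + \<theta> i))"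
proof -
  define p where "p i = [:\<theta> i, 1:]" for i
  \<comment> \<open>\<open>A i\<close> is the contribution of the pole \<open>- \<theta> i\<close>
    multiplied by \<open>p i ^ 3\<close>; \<open>T i\<close> is that contribution multiplied by the
    whole common denominator.\<close>
  define A where "A i = [:\<theta> i * G i:] + [:\<theta> i * G i * L i:] * p i
    + [:\<theta> i * G i / 2 * (L i)\<^sup>2 + \<theta> i * G i / 2 * (2 / \<theta> i + K i):] * (p i)\<^sup>2" for i
  define T where "T i = A i * (\<Prod>j\<in>I - {i}. p j ^ 3)" for i
  define P where "P = (\<Prod>j\<in>I. (p j)\<^sup>2 + [:\<theta> j:]) - (\<Sum>i\<in>I. T i)"
  \<comment> \<open>Recentring at the pole \<open>- \<theta> i\<close>: there \<open>p i\<close> is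
    the local variable and plays the role of \<open>u\<close> in the expansions.\<close>
  have p_shift: "p j = p i + [:\<theta> j - \<theta> i:]" for i j by (simp add: p_def)
  have "P = 0"
  proof (rule poly_eq_0_if_cubes_dvd[OF I(1)])
    show "inj_on (\<lambda>i. - \<theta> i) I" using inj by (simp add: inj_on_def)
    show "[:- (- \<theta> i), 1:] ^ 3 dvd P" if i: "i \<in> I" for i
    proof -
      let ?D = "\<Prod>j\<in>I - {i}. p j ^ 3"
      let ?E = "1 + [:L i:] * p i + [:((L i)\<^sup>2 + K i) / 2:] * (p i)\<^sup>2"
      have "p i ^ 3 dvd (\<Prod>j\<in>I - {i}. (p i + [:\<theta> j - \<theta> i:])\<^sup>2 + [:\<theta> j:])
        - [:G i:] * ?E * (\<Prod>j\<in>I - {i}. (p i + [:\<theta> j - \<theta> i:]) ^ 3)"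
        unfolding G_def L_def K_def
        using I(1) inj nz2 i by (intro prod_quadratic_over_cube_expansion) (auto simp: inj_on_def)
      then have cofactor: "p i ^ 3 dvd (\<Prod>j\<in>I - {i}. (p j)\<^sup>2 + [:\<theta> j:]) - [:G i:] * ?E * ?D"
        by (simp add: p_shift[symmetric])
      \<comment> \<open>The factor of index \<open>i\<close> itself has numerator
        \<open>(p i) ^ 2 + \<theta> i\<close>. Multiplying the expansion of the other factors by it
        and truncating gives \<open>A i\<close>; its square term adds \<open>G i\<close> to the
        quadratic coefficient, which is the source of \<open>2 / \<theta> i\<close>.\<close>
      have *: "((p i)\<^sup>2 + [:\<theta> i:]) * ([:G i:] * ?E) - A i
        = p i ^ 3 * ([:G i:] * ([:L i:] + [:((L i)\<^sup>2 + K i) / 2:] * p i))"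
      proof -
        have A: "A i = [:\<theta> i:] * [:G i:] + [:\<theta> i:] * [:G i:] * [:L i:] * p i
          + ([:\<theta> i:] * [:G i:] * [:((L i)\<^sup>2 + K i) / 2:] + [:G i:]) * (p i)\<^sup>2"
        proof -
          have q: "\<theta> i * G i / 2 * (L i)\<^sup>2 + \<theta> i * G i / 2 * (2 / \<theta> i + K i)
            = \<theta> i * (G i * (((L i)\<^sup>2 + K i) / 2)) + G i"
            using nz[OF i] by (simp add: field_simps)
          show ?thesis unfolding A_def q by (simp add: algebra_simps)
        qed
        show ?thesis unfolding A
          by (simp only: algebra_simps power2_eq_square power3_eq_cube mult_1_left mult_1_right)
      qed
      have own: "p i ^ 3 dvd (\<Prod>j\<in>I. (p j)\<^sup>2 + [:\<theta> j:]) - T i"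
      proof -
        have "(\<Prod>j\<in>I. (p j)\<^sup>2 + [:\<theta> j:]) - T i =
          ((p i)\<^sup>2 + [:\<theta> i:]) * ((\<Prod>j\<in>I - {i}. (p j)\<^sup>2 + [:\<theta> j:]) - [:G i:] * ?E * ?D)
          + (((p i)\<^sup>2 + [:\<theta> i:]) * ([:G i:] * ?E) - A i) * ?D"
          unfolding T_def prod.remove[OF I(1) i] by (simp only: algebra_simps)
        then show ?thesis
          unfolding * using cofactor by (simp only: dvd_add dvd_mult dvd_mult2 dvd_triv_left)
      qed
      \<comment> \<open>The contributions of the other poles keep \<open>p i ^ 3\<close> from the
        common denominator.\<close>
      have rest: "p i ^ 3 dvd (\<Sum>k\<in>I - {i}. T k)"
      proof (rule dvd_sum)
        fix k assume "k \<in> I - {i}"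
        then have "p i ^ 3 dvd (\<Prod>j\<in>I - {k}. p j ^ 3)"
          using I(1) i by (intro dvd_prodI) auto
        then show "p i ^ 3 dvd T k" by (simp add: T_def)
      qed
      have "P = ((\<Prod>j\<in>I. (p j)\<^sup>2 + [:\<theta> j:]) - T i) - (\<Sum>k\<in>I - {i}. T k)"
        unfolding P_def sum.remove[OF I(1) i] by simp
      then show ?thesis using own rest by (simp add: p_def)
    qed
    \<comment> \<open>Nonemptiness matters: subtraction on naturals is truncated, so a bound by
      \<open>3 * card I - 1\<close> is strict only if \<open>card I\<close> is positive.\<close>
    have card: "card I > 0" using I by (simp add: card_gt_0_iff)
    have degp2: "degree ((p j)\<^sup>2 + [:c:]) \<le> 2" for j c
      by (simp add: p_def power2_eq_square)
    have degp3: "degree (p j ^ 3) \<le> 3" for j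
      using degree_power_le[of "p j" 3] by (simp add: p_def)
    have "degree (\<Prod>j\<in>I. (p j)\<^sup>2 + [:\<theta> j:]) \<le> (\<Sum>j\<in>I. 2)"
      by (rule order_trans[OF degree_prod_sum_le sum_mono]) (use I(1) degp2 in auto)
    then have d1: "degree (\<Prod>j\<in>I. (p j)\<^sup>2 + [:\<theta> j:]) \<le> 3 * card I - 1"
      using card by simp
    have d2: "degree (T i) \<le> 3 * card I - 1" if i: "i \<in> I" for i
    proof -
      have "degree (\<Prod>j\<in>I - {i}. p j ^ 3) \<le> (\<Sum>j\<in>I - {i}. 3)"
        by (rule order_trans[OF degree_prod_sum_le sum_mono]) (use I(1) degp3 in auto)
      also have "\<dots> = 3 * (card I - 1)" using i I(1) by simp
      finally have *: "degree (\<Prod>j\<in>I - {i}. p j ^ 3) \<le> 3 * (card I - 1)" .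
      have "degree (A i) \<le> 2" by (simp add: A_def p_def power2_eq_square)
      with * have "degree (T i) \<le> 2 + 3 * (card I - 1)"
        unfolding T_def by (intro order_trans[OF degree_mult_le]) simp
      then show ?thesis using card by simp
    qed
    have "degree P \<le> 3 * card I - 1"
      unfolding P_def using d1 d2 by (intro degree_diff_le degree_sum_le I(1)) auto
    then show "degree P < 3 * card I" using card by simp
  qed
  then have "poly P s = 0" by simp
  then have eq: "(\<Prod>j\<in>I. (s + \<theta> j)\<^sup>2 + \<theta> j) = (\<Sum>i\<in>I. poly (A i) s * (\<Prod>j\<in>I - {i}. (s + \<theta> j) ^ 3))"
    by (simp add: P_def T_def p_def poly_prod poly_sum algebra_simps)
  define D where "D = (\<Prod>j\<in>I. (s + \<theta> j) ^ 3)"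
  have D: "D \<noteq> 0" using s I(1) by (simp add: D_def)
  have "(\<Prod>j\<in>I. ((s + \<theta> j)\<^sup>2 + \<theta> j) / (s + \<theta> j) ^ 3)
      = (\<Sum>i\<in>I. poly (A i) s * (\<Prod>j\<in>I - {i}. (s + \<theta> j) ^ 3) / D)"
    by (simp add: prod_dividef eq D_def sum_divide_distrib)
  also have "\<dots> = (\<Sum>i\<in>I. poly (A i) s / (s + \<theta> i) ^ 3)"
  proof (rule sum.cong)
    fix i assume i: "i \<in> I"
    have "D = (s + \<theta> i) ^ 3 * (\<Prod>j\<in>I - {i}. (s + \<theta> j) ^ 3)"
      unfolding D_def by (rule prod.remove[OF I(1) i])
    then show "poly (A i) s * (\<Prod>j\<in>I - {i}. (s + \<theta> j) ^ 3) / D = poly (A i) s / (s + \<theta> i) ^ 3"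
      using D by simp
  qed simp
  also have "\<dots> = (\<Sum>i\<in>I. \<theta> i * G i / (s + \<theta> i) ^ 3 + \<theta> i * G i * L i / (s + \<theta> i)\<^sup>2
      + (\<theta> i * G i / 2 * (L i)\<^sup>2 + \<theta> i * G i / 2 * (2 / \<theta> i + K i)) / (s + \<theta> i))"
  proof (rule sum.cong)
    fix i assume i: "i \<in> I"
    have frac: "(a + b * w + c * w\<^sup>2) / w ^ 3 = a / w ^ 3 + b / w\<^sup>2 + c / w" if "w \<noteq> 0" for a b c w :: 'a
      using that by (simp add: field_simps power2_eq_square power3_eq_cube)
    have poly_p: "poly (p i) s = s + \<theta> i" by (simp add: p_def)
    have "poly (A i) s = \<theta> i * G i + \<theta> i * G i * L i * (s + \<theta> i)
      + (\<theta> i * G i / 2 * (L i)\<^sup>2 + \<theta> i * G i / 2 * (2 / \<theta> i + K i)) * (s + \<theta> i)\<^sup>2"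
      using poly_p by (simp add: A_def)
    then show "poly (A i) s / (s + \<theta> i) ^ 3 = \<theta> i * G i / (s + \<theta> i) ^ 3 + \<theta> i * G i * L i / (s + \<theta> i)\<^sup>2
      + (\<theta> i * G i / 2 * (L i)\<^sup>2 + \<theta> i * G i / 2 * (2 / \<theta> i + K i)) / (s + \<theta> i)"
      using frac[OF s[OF i]] by simp
  qed simp
  finally show ?thesis .
qed

section \<open>From characteristic functions to distribution functions\<close>

lemma interval_lebesgue_integral_finite_sum:
  fixes f :: "'i \<Rightarrow> real \<Rightarrow> 'a::{banach, second_countable_topology}"
  assumes "finite I" and "\<And>i. i \<in> I \<Longrightarrow> interval_lebesgue_integrable lborel a b (f i)"
  shows "interval_lebesgue_integral lborel a b (\<lambda>x. \<Sum>i\<in>I. f i x)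
      = (\<Sum>i\<in>I. interval_lebesgue_integral lborel a b (f i))"
proof -
  \<comment> \<open>Integrability of the partial sum is carried through the induction, since
    additivity of the integral requires it.\<close>
  have "interval_lebesgue_integrable lborel a b (\<lambda>x. \<Sum>i\<in>I. f i x) \<and> ?thesis"
    using assms
    by (induction I rule: finite_induct)
      (simp_all add: interval_lebesgue_integral_add, simp add: interval_lebesgue_integrable_def set_integrable_def)
  then show ?thesis ..
qed

text \<open>The kernel is bounded by \<open>b - a\<close> and the characteristic function by 1,
  which suffices on a bounded interval; \<open>t = 0\<close> is discarded as a null set. This
  permits exchanging the inversion integral with finite sums.\<close>

lemma (in real_distribution) Levy_kernel_integrable:
  fixes a b S T :: real
  assumes "a \<le> b"
  shows "complex_interval_lebesgue_integrable lborel (ereal S) (ereal T)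
    (\<lambda>t. (iexp (- (t * a)) - iexp (- (t * b))) / (\<i> * t) * char M t)"
proof -
  have bound: "cmod ((iexp (- (t * a)) - iexp (- (t * b))) / (\<i> * t) * char M t) \<le> b - a"
    if "t \<noteq> 0" for t
  proof -
    have "cmod ((iexp (- (t * a)) - iexp (- (t * b))) / (\<i> * t)) * cmod (char M t) \<le> (b - a) * 1"
      using Levy_Inversion_aux2[of "- b" "- a" t] that assms cmod_char_le_1[of t]
      by (intro mult_mono) auto
    then show ?thesis by (simp only: norm_mult mult_1_right)
  qed
  show ?thesis
    unfolding interval_lebesgue_integrable_def set_integrable_def
    using bound
    by (auto intro!: integrableI_bounded_set_indicator[where B="b - a"] AE_I[of _ _ "{0}"])
qed

text \<open>The weights may have any sign. Inversion shows that the difference \<open>D\<close> of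
  the two sides is constant off a countable set, the limit at minus infinity makes that constant
  zero, and right continuity covers the remaining points.\<close>

lemma cdf_eq_sum_if_char_eq_sum:
  fixes \<nu> :: "'i \<Rightarrow> real measure" and c :: "'i \<Rightarrow> real"
  assumes \<mu>: "real_distribution \<mu>" and I: "finite I"
    and \<nu>: "\<And>i. i \<in> I \<Longrightarrow> real_distribution (\<nu> i)"
    and char: "\<And>u. char \<mu> u = (\<Sum>i\<in>I. c i * char (\<nu> i) u)"
  shows "cdf \<mu> x = (\<Sum>i\<in>I. c i * cdf (\<nu> i) x)"
proof -
  interpret \<mu>: real_distribution \<mu> by (rule \<mu>)
  \<comment> \<open>All atoms of the measures involved: the inversion formula needs endpoints of
    mass zero. Finite measures have countably many atoms, so the complement of \<open>B\<close>
    meets every nonempty open set.\<close>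
  define B where "B = {y. measure \<mu> {y} \<noteq> 0} \<union> (\<Union>i\<in>I. {y. measure (\<nu> i) {y} \<noteq> 0})"
  have fin: "finite_measure (\<nu> i)" if "i \<in> I" for i
    using \<nu>[OF that] by (simp add: real_distribution_def prob_space_def)
  have cB: "countable B"
    unfolding B_def using I fin
    by (intro countable_Un countable_UN \<mu>.countable_support finite_measure.countable_support)
      (auto intro: countable_finite)
  define D where "D y = cdf \<mu> y - (\<Sum>i\<in>I. c i * cdf (\<nu> i) y)" for y
  have const: "D a = D b" if ab: "a < b" "a \<notin> B" "b \<notin> B" for a b
  proof -
    let ?J = "\<lambda>\<sigma> T. 1 / (2 * pi) * (CLBINT t=ereal (real_of_int (- int T))..ereal (real T). (iexp (-(t * a)) - iexp (-(t * b))) / (\<i> * t) * char \<sigma> t)"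
    have le: "a \<le> b" using ab by simp
    have lim\<nu>: "(\<lambda>T. ?J (\<nu> i) T) \<longlonglongrightarrow> measure (\<nu> i) {a<..b}" if "i \<in> I" for i
      using ab that by (intro real_distribution.Levy_Inversion \<nu>) (auto simp: B_def)
    have lim: "(\<lambda>T. \<Sum>i\<in>I. c i * ?J (\<nu> i) T) \<longlonglongrightarrow> (\<Sum>i\<in>I. c i * complex_of_real (measure (\<nu> i) {a<..b}))"
      by (intro tendsto_sum tendsto_mult tendsto_const lim\<nu>)
    \<comment> \<open>The truncated inversion integral is linear in the characteristic function, so
      the assumed identity passes to it for every \<open>T\<close>.\<close>
    have J: "?J \<mu> T = (\<Sum>i\<in>I. c i * ?J (\<nu> i) T)" for T
    proof -
      let ?F = "\<lambda>t::real. (iexp (-(t * a)) - iexp (-(t * b))) / (\<i> * t)"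
      have "(CLBINT t=ereal (real_of_int (- int T))..ereal (real T). ?F t * char \<mu> t) =
        (CLBINT t=ereal (real_of_int (- int T))..ereal (real T). (\<Sum>i\<in>I. c i * (?F t * char (\<nu> i) t)))"
        by (simp add: char sum_distrib_left mult.left_commute)
      also have "\<dots> = (\<Sum>i\<in>I. (CLBINT t=ereal (real_of_int (- int T))..ereal (real T). c i * (?F t * char (\<nu> i) t)))"
        using I real_distribution.Levy_kernel_integrable[OF \<nu> le]
        by (intro interval_lebesgue_integral_finite_sum interval_lebesgue_integrable_mult_right) auto
      also have "\<dots> = (\<Sum>i\<in>I. c i * (CLBINT t=ereal (real_of_int (- int T))..ereal (real T). ?F t * char (\<nu> i) t))"
        by (simp only: interval_lebesgue_integral_mult_right)
      finally show ?thesis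
        by (simp only: sum_distrib_left mult.left_commute)
    qed
    have "(\<lambda>T. ?J \<mu> T) \<longlonglongrightarrow> measure \<mu> {a<..b}"
      using ab by (intro \<mu>.Levy_Inversion) (auto simp: B_def)
    then have "complex_of_real (measure \<mu> {a<..b}) = (\<Sum>i\<in>I. c i * complex_of_real (measure (\<nu> i) {a<..b}))"
      unfolding J using lim by (rule LIMSEQ_unique)
    also have "\<dots> = complex_of_real (\<Sum>i\<in>I. c i * measure (\<nu> i) {a<..b})" by simp
    finally have "measure \<mu> {a<..b} = (\<Sum>i\<in>I. c i * measure (\<nu> i) {a<..b})"
      by (simp only: of_real_eq_iff)
    moreover have "cdf (\<nu> i) b - cdf (\<nu> i) a = measure (\<nu> i) {a<..b}" if "i \<in> I" for i
    proof -
      interpret real_distribution "\<nu> i" by (rule \<nu>[OF that])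
      show ?thesis by (rule cdf_diff_eq[OF ab(1)])
    qed
    moreover have "cdf \<mu> b - cdf \<mu> a = measure \<mu> {a<..b}" by (rule \<mu>.cdf_diff_eq[OF ab(1)])
    ultimately have "cdf \<mu> b - cdf \<mu> a = (\<Sum>i\<in>I. c i * (cdf (\<nu> i) b - cdf (\<nu> i) a))"
      by simp
    then show ?thesis by (simp add: D_def right_diff_distrib sum_subtractf)
  qed
  have bot: "(D \<longlongrightarrow> 0) at_bot"
  proof -
    have "(cdf (\<nu> i) \<longlongrightarrow> 0) at_bot" if "i \<in> I" for i
    proof -
      interpret real_distribution "\<nu> i" by (rule \<nu>[OF that])
      show ?thesis by (rule cdf_lim_at_bot)
    qed
    then have "(D \<longlongrightarrow> 0 - (\<Sum>i\<in>I. c i * 0)) at_bot"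
      unfolding D_def by (intro tendsto_intros \<mu>.cdf_lim_at_bot)
    then show ?thesis by simp
  qed
  \<comment> \<open>A nonzero value \<open>D b\<close> would recur at points \<open>a\<close>
    outside \<open>B\<close> arbitrarily far to the left, against the limit zero.\<close>
  have zero: "D b = 0" if b: "b \<notin> B" for b
  proof (rule ccontr)
    assume "D b \<noteq> 0"
    then have "eventually (\<lambda>y. dist (D y) 0 < \<bar>D b\<bar> \<and> y < b) at_bot"
      using bot by (intro eventually_conj tendstoD eventually_gt_at_bot) auto
    then obtain N where N: "\<And>y. y \<le> N \<Longrightarrow> \<bar>D y\<bar> < \<bar>D b\<bar> \<and> y < b"
      unfolding eventually_at_bot_linorder by auto
    obtain a where "a < N" "a \<notin> B"
      using open_minus_countable[OF cB, of "{..<N}"] by auto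
    then show False using N[of a] const[of a b] b by simp
  qed
  have right: "(D \<longlongrightarrow> D x) (at_right x)"
  proof -
    have "(cdf (\<nu> i) \<longlongrightarrow> cdf (\<nu> i) x) (at_right x)" if "i \<in> I" for i
    proof -
      interpret real_distribution "\<nu> i" by (rule \<nu>[OF that])
      show ?thesis using cdf_is_right_cont[of x] by (simp add: continuous_within)
    qed
    moreover have "(cdf \<mu> \<longlongrightarrow> cdf \<mu> x) (at_right x)"
      using \<mu>.cdf_is_right_cont[of x] by (simp add: continuous_within)
    ultimately show ?thesis unfolding D_def by (intro tendsto_intros)
  qed
  \<comment> \<open>\<open>x\<close> may be an atom; it is approached from the right by points
    outside \<open>B\<close>, where \<open>D\<close> vanishes.\<close>
  have "D x = 0"
  proof (rule ccontr)
    assume "D x \<noteq> 0"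
    then have "eventually (\<lambda>y. dist (D y) (D x) < \<bar>D x\<bar>) (at_right x)"
      using right by (intro tendstoD) auto
    then obtain N where N: "N > x" "\<And>y. x < y \<Longrightarrow> y < N \<Longrightarrow> \<bar>D y - D x\<bar> < \<bar>D x\<bar>"
      by (auto simp: eventually_at_right[OF less_add_one] dist_real_def)
    obtain b where "x < b" "b < N" "b \<notin> B"
      using open_minus_countable[OF cB, of "{x<..<N}"] N(1) by auto
    then show False using N(2)[of b] zero[of b] by simp
  qed
  then show ?thesis by (simp add: D_def)
qed

section \<open>Characteristic functions of the Erlang and XGamma distributions\<close>

text \<open>The Laplace transform of \<open>x ^ k / fact k\<close> at a complex argument:
  integrability by comparison with an Erlang density, the value from an explicit
  antiderivative.\<close>

lemma integral_power_exp_complex: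
  fixes z :: complex
  assumes z: "0 < Re z"
  shows "integrable lborel (\<lambda>x. indicator {0..} x *\<^sub>R (of_real (x ^ k / fact k) * exp (- z * of_real x)))" (is "integrable _ ?f")
    and "(CLBINT x. indicator {0..} x *\<^sub>R (of_real (x ^ k / fact k) * exp (- z * of_real x))) = 1 / z ^ Suc k"
proof -
  interpret E: prob_space "density lborel (erlang_density k (Re z))"
    by (rule prob_space_erlang_density[OF z])
  have "integrable lborel (\<lambda>x. erlang_density k (Re z) x *\<^sub>R (1::real))"
    using z E.integrable_const[of "1::real"]
    by (subst (asm) integrable_density) auto
  then have intE: "integrable lborel (erlang_density k (Re z))" by simp
  \<comment> \<open>Since \<open>exp (- z * x)\<close> has modulus \<open>exp (- Re z * x)\<close>,
    the modulus of the integrand is a multiple of the Erlang density of rate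
    \<open>Re z\<close>.\<close>
  have nf: "norm (?f x) = (1 / Re z ^ Suc k) * erlang_density k (Re z) x" for x
    using z by (auto simp: erlang_density_def norm_mult norm_divide norm_power norm_exp_eq_Re indicator_def)
  have meas: "?f \<in> borel_measurable lborel" by measurable
  show int: "integrable lborel ?f"
    by (rule Bochner_Integration.integrable_bound[OF integrable_mult_right[OF intE, of "1 / Re z ^ Suc k"] meas])
      (simp only: nf real_norm_def abs_ge_self AE_I2)
  have z0: "z \<noteq> 0" using z by auto
  \<comment> \<open>Repeated integration by parts gives the antiderivative \<open>F\<close>; its
    polynomial part \<open>Q\<close> solves \<open>Q' = z * Q - x ^ k / fact k\<close>.\<close>
  define Q where "Q x = (\<Sum>j\<le>k. of_real (x ^ j / fact j) / z ^ (Suc k - j))" for x :: real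
  define F where "F x = - exp (- z * of_real x) * Q x" for x :: real
  have lim: "(F \<longlongrightarrow> 0) at_top"
  proof -
    have "((\<lambda>x. of_real (x ^ j / fact j) * exp (- z * of_real x)) \<longlongrightarrow> 0) at_top" for j
    proof (rule tendsto_norm_zero_cancel)
      have "((\<lambda>x. (1 / (fact j * Re z ^ j)) * ((Re z * x) ^ j / exp (Re z * x))) \<longlongrightarrow> (1 / (fact j * Re z ^ j)) * 0) at_top"
        using z
        by (intro tendsto_mult tendsto_const filterlim_compose[OF tendsto_power_div_exp_0]
            filterlim_tendsto_pos_mult_at_top[OF tendsto_const _ filterlim_ident])
      then have "((\<lambda>x. x ^ j / fact j * exp (- (Re z * x))) \<longlongrightarrow> 0) at_top"
        using z by (simp add: power_mult_distrib exp_minus field_simps)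
      moreover have "eventually (\<lambda>x. norm (of_real (x ^ j / fact j) * exp (- z * of_real x)) = x ^ j / fact j * exp (- (Re z * x))) at_top"
        using eventually_ge_at_top[of 0] by eventually_elim (simp add: norm_mult norm_divide norm_power norm_exp_eq_Re)
      ultimately show "((\<lambda>x. norm (of_real (x ^ j / fact j) * exp (- z * of_real x))) \<longlongrightarrow> 0) at_top"
        by (simp add: tendsto_cong)
    qed
    then have "((\<lambda>x. - (\<Sum>j\<le>k. of_real (x ^ j / fact j) * exp (- z * of_real x) / z ^ (Suc k - j))) \<longlongrightarrow> - (\<Sum>j\<le>k. 0 / z ^ (Suc k - j))) at_top"
      using z0 by (intro tendsto_minus tendsto_sum tendsto_divide tendsto_const) auto
    then show ?thesis
      by (simp add: F_def[abs_def] Q_def sum_distrib_left sum_negf[symmetric] mult.commute)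
  qed
  have dQ: "(Q has_vector_derivative z * Q x - of_real (x ^ k / fact k)) (at x within S)" for x S
    unfolding Q_def
  proof (induction k)
    case 0
    then show ?case using z0 by simp
  next
    case (Suc k)
    \<comment> \<open>The recursion in \<open>k\<close>: raising \<open>k\<close> by one divides the
      old sum by \<open>z\<close> and adds one top term.\<close>
    have eq: "(\<Sum>j\<le>Suc k. complex_of_real (x ^ j / fact j) / z ^ (Suc (Suc k) - j))
       = (\<Sum>j\<le>k. of_real (x ^ j / fact j) / z ^ (Suc k - j)) / z + of_real (x ^ Suc k / fact (Suc k)) / z" for x
    proof -
      have "w / z ^ (Suc (Suc k) - j) = w / z ^ (Suc k - j) / z" if "j \<le> k" for w j
        using that by (simp add: Suc_diff_le mult.commute)
      then show ?thesis
        unfolding sum.atMost_Suc sum_divide_distrib by (intro arg_cong2[where f="(+)"] sum.cong) auto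
    qed
    have d: "((\<lambda>x. x ^ Suc k / fact (Suc k)) has_real_derivative x ^ k / fact k) (at x within S)"
      using DERIV_cdivide[OF DERIV_pow[of "Suc k" x S], of "fact (Suc k)"] by simp
    have "((\<lambda>x. complex_of_real (x ^ Suc k / fact (Suc k))) has_vector_derivative of_real (x ^ k / fact k)) (at x within S)"
      using has_vector_derivative_of_real[OF d] .
    note D = has_vector_derivative_add[OF has_vector_derivative_divide[OF Suc, of z] has_vector_derivative_divide[OF this, of z]]
    have alg: "(z * v - w) / z + w / z = z * (v / z + y / z) - y" for v w y
      using z0 by (simp add: field_simps)
    show ?case unfolding eq by (rule has_vector_derivative_eq_rhs[OF D alg])
  qed
  have dF: "(F has_vector_derivative of_real (x ^ k / fact k) * exp (- z * of_real x)) (at x within S)" for x S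
  proof -
    have "((\<lambda>x. exp (- z * of_real x)) has_vector_derivative (- z * exp (- z * of_real x))) (at x within S)"
      by (rule has_vector_derivative_real_field) (auto intro!: derivative_eq_intros)
    from has_vector_derivative_mult[OF has_vector_derivative_minus[OF this] dQ[of x S]]
    show ?thesis unfolding F_def[abs_def] by (simp add: algebra_simps)
  qed
  have FTC: "(CLBINT x. indicator {..b} x *\<^sub>R ?f x) = F b - F 0" if "0 \<le> b" for b
  proof -
    have "(CLBINT x. indicator {..b} x *\<^sub>R ?f x) = (CLBINT x. indicator {0..b} x *\<^sub>R (of_real (x ^ k / fact k) * exp (- z * of_real x)))"
      by (intro Bochner_Integration.integral_cong) (auto simp: indicator_def)
    also have "\<dots> = F b - F 0"
      by (rule integral_FTC_atLeastAtMost[OF that dF]) (intro continuous_intros, auto)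
    finally show ?thesis .
  qed
  have "((\<lambda>b. CLBINT x. indicator {..b} x *\<^sub>R ?f x) \<longlongrightarrow> integral\<^sup>L lborel ?f) at_top"
    by (rule tendsto_integral_at_top[OF _ int]) simp
  moreover have "eventually (\<lambda>b. (CLBINT x. indicator {..b} x *\<^sub>R ?f x) = F b - F 0) at_top"
    using eventually_ge_at_top[of 0] by eventually_elim (rule FTC)
  ultimately have "((\<lambda>b. F b - F 0) \<longlongrightarrow> integral\<^sup>L lborel ?f) at_top"
    by (simp add: tendsto_cong)
  moreover have "((\<lambda>b. F b - F 0) \<longlongrightarrow> 0 - F 0) at_top"
    by (intro tendsto_intros lim)
  ultimately have "integral\<^sup>L lborel ?f = 0 - F 0"
    by (intro tendsto_unique[OF trivial_limit_at_top_linorder])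
  then have "integral\<^sup>L lborel ?f = - F 0" by simp
  \<comment> \<open>At \<open>0\<close> only the summand \<open>j = 0\<close> of \<open>Q\<close>
    survives.\<close>
  also have "\<dots> = 1 / z ^ Suc k"
    by (simp add: F_def Q_def power_0_left if_distrib sum.atMost_shift cong: if_cong)
  finally show "integral\<^sup>L lborel ?f = 1 / z ^ Suc k" .
qed

lemma char_distr_density:
  assumes "distributed M lborel X f" and "\<And>x. 0 \<le> f x"
  shows "char (distr M borel X) u = (CLBINT x. f x *\<^sub>R iexp (u * x))"
proof -
  have f: "f \<in> borel_measurable lborel"
    using distributed_real_measurable[of lborel f M X] assms by auto
  have "distr M borel X = density lborel f"
    using distributed_distr_eq_density[OF assms(1)] by (simp cong: distr_cong)
  then show ?thesis
    unfolding char_def using f assms(2) by (simp add: integral_density)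
qed

text \<open>The Laplace integral at \<open>z = l - \<i> * u\<close>, scaled by
  \<open>l ^ Suc k\<close>.\<close>

lemma erlang_density_char_integral:
  assumes l: "0 < l"
  shows "integrable lborel (\<lambda>x. erlang_density k l x *\<^sub>R iexp (u * x))" (is ?int)
    and "(CLBINT x. erlang_density k l x *\<^sub>R iexp (u * x)) = (l / (l - \<i> * u)) ^ Suc k" (is ?eq)
proof -
  let ?z = "complex_of_real l - \<i> * u"
  have z: "0 < Re ?z" using l by simp
  have eq: "erlang_density k l x *\<^sub>R iexp (u * x) =
    of_real (l ^ Suc k) * (indicator {0..} x *\<^sub>R (of_real (x ^ k / fact k) * exp (- ?z * of_real x)))" for x
  proof -
    have "exp (- ?z * of_real x) = of_real (exp (- l * x)) * iexp (u * x)"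
      by (simp add: exp_add[symmetric] exp_of_real[symmetric] algebra_simps)
    then show ?thesis by (simp add: erlang_density_def scaleR_conv_of_real)
  qed
  show ?int unfolding eq by (intro integrable_mult_right integral_power_exp_complex z)
  show ?eq unfolding eq integral_mult_right_zero integral_power_exp_complex(2)[OF z]
    by (simp add: power_divide)
qed

lemma char_Erl_distributed:
  assumes "Erl_distributed M Y m \<theta>"
  shows "char (distr M borel Y) u = (\<theta> / (\<theta> - \<i> * u)) ^ m"
proof -
  from assms have m: "1 \<le> m" and \<theta>: "0 < \<theta>" and Y: "distributed M lborel Y (erlang_density (m - 1) \<theta>)"
    by (auto simp: Erl_distributed_def)
  show ?thesis
    using char_distr_density[OF Y, of u] erlang_density_char_integral(2)[OF \<theta>, of "m - 1" u] m \<theta>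
    by simp
qed

text \<open>The XGamma law is the mixture of the Erlang laws of shapes 1 and 3 with weights
  \<open>\<theta> / (1 + \<theta>)\<close> and \<open>1 / (1 + \<theta>)\<close>.\<close>

lemma char_XG_distributed:
  assumes "XG_distributed M X \<theta>"
  shows "char (distr M borel X) u =
    of_real (\<theta>\<^sup>2 / (1 + \<theta>)) * (((\<theta> - \<i> * u)\<^sup>2 + \<theta>) / (\<theta> - \<i> * u) ^ 3)"
proof -
  from assms have \<theta>: "0 < \<theta>" and X: "distributed M lborel X (xgamma_density \<theta>)"
    by (auto simp: XG_distributed_def)
  let ?e = "\<lambda>k x. erlang_density k \<theta> x *\<^sub>R iexp (u * x)"
  let ?c = "\<theta>\<^sup>2 / (1 + \<theta>)"
  \<comment> \<open>At \<open>x = 0\<close> the identity fails: \<open>xgamma_density\<close> is 0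
    there and \<open>erlang_density 0 \<theta>\<close> is \<open>\<theta>\<close>. Almost everywhere
    equality is enough below.\<close>
  have eq: "xgamma_density \<theta> x = ?c * (erlang_density 0 \<theta> x / \<theta> + erlang_density 2 \<theta> x / \<theta>\<^sup>2)"
    if "x \<noteq> 0" for x
  proof -
    have "(1 + \<theta> / 2 * x\<^sup>2) * exp (- \<theta> * x) = erlang_density 0 \<theta> x / \<theta> + erlang_density 2 \<theta> x / \<theta>\<^sup>2"
      if "0 < x"
      using \<theta> that by (simp add: erlang_density_def field_simps power2_eq_square power3_eq_cube fact_2)
    then show ?thesis
      using that by (cases "0 < x") (simp_all add: xgamma_density_def erlang_density_def mult.assoc)
  qed
  have nz: "complex_of_real \<theta> - \<i> * u \<noteq> 0" using \<theta> by (auto simp: complex_eq_iff)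
  have [measurable]: "xgamma_density \<theta> \<in> borel_measurable borel"
    unfolding xgamma_density_def[abs_def] by measurable
  have "char (distr M borel X) u = (CLBINT x. xgamma_density \<theta> x *\<^sub>R iexp (u * x))"
    using \<theta> by (intro char_distr_density X) (auto simp: xgamma_density_def)
  also have "\<dots> = (CLBINT x. of_real ?c * (of_real (1 / \<theta>) * ?e 0 x + of_real (1 / \<theta>\<^sup>2) * ?e 2 x))"
  proof (rule integral_cong_AE)
    show "AE x in lborel. xgamma_density \<theta> x *\<^sub>R iexp (u * x) =
      of_real ?c * (of_real (1 / \<theta>) * ?e 0 x + of_real (1 / \<theta>\<^sup>2) * ?e 2 x)"
      by (rule AE_mp[OF AE_lborel_singleton[of 0]])
        (auto simp: eq scaleR_conv_of_real algebra_simps)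
  qed auto
  also have "\<dots> = of_real ?c * (of_real (1 / \<theta>) * (\<theta> / (\<theta> - \<i> * u)) ^ Suc 0 + of_real (1 / \<theta>\<^sup>2) * (\<theta> / (\<theta> - \<i> * u)) ^ Suc 2)"
    using erlang_density_char_integral[OF \<theta>]
    by (simp only: integral_mult_right_zero Bochner_Integration.integral_add integrable_mult_right)
  also have "\<dots> = of_real ?c * (((\<theta> - \<i> * u)\<^sup>2 + \<theta>) / (\<theta> - \<i> * u) ^ 3)"
    using \<theta> nz by (intro arg_cong2[where f="(*)"] refl) (simp add: divide_simps power2_eq_square power3_eq_cube eval_nat_numeral)
  finally show ?thesis .
qed

section \<open>The HypoXG coefficients and the distribution function of the sum\<close>

text \<open>The general expansion is applied to the parameters embedded in the complex numbers; the
  nonvanishing of its denominators is derived from positivity over the reals first.\<close>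

lemma hypoxg_partial_fractions:
  fixes \<theta> :: "nat \<Rightarrow> real" and s :: complex
  assumes n: "1 \<le> n" and pos: "\<And>i. i \<in> {1..n} \<Longrightarrow> 0 < \<theta> i" and inj: "inj_on \<theta> {1..n}"
    and s: "\<And>i. i \<in> {1..n} \<Longrightarrow> s + complex_of_real (\<theta> i) \<noteq> 0"
  shows "(\<Prod>j\<in>{1..n}. ((s + complex_of_real (\<theta> j))\<^sup>2 + complex_of_real (\<theta> j)) / (s + complex_of_real (\<theta> j)) ^ 3) =
    (\<Sum>i\<in>{1..n}. complex_of_real (hypoxg_A1 n \<theta> i) / (s + complex_of_real (\<theta> i)) ^ 3
      + complex_of_real (hypoxg_A2 n \<theta> i) / (s + complex_of_real (\<theta> i))\<^sup>2
      + complex_of_real (hypoxg_A3 n \<theta> i) / (s + complex_of_real (\<theta> i)))"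
proof -
  define z where "z j = complex_of_real (\<theta> j)" for j
  have nz: "(z j - z i)\<^sup>2 + z j \<noteq> 0" if "j \<in> {1..n}" for i j
  proof -
    have "(\<theta> j - \<theta> i)\<^sup>2 + \<theta> j \<noteq> 0"
      using pos[OF that] zero_le_power2[of "\<theta> j - \<theta> i"] by linarith
    moreover have "(z j - z i)\<^sup>2 + z j = complex_of_real ((\<theta> j - \<theta> i)\<^sup>2 + \<theta> j)"
      by (simp add: z_def)
    ultimately show ?thesis by (simp only: of_real_eq_0_iff not_False_eq_True)
  qed
  have inj_z: "inj_on z {1..n}"
    using inj by (intro inj_onI) (simp add: z_def inj_on_eq_iff)
  have z0: "z i \<noteq> 0" if "i \<in> {1..n}" for i
    using pos[OF that] by (simp add: z_def)
  have sz: "s + z i \<noteq> 0" if "i \<in> {1..n}" for i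
    using s[OF that] by (simp add: z_def)
  have ne: "{1..n} \<noteq> {}" using n by simp
  show ?thesis
    using partial_fractions_triple_poles[OF finite_atLeastAtMost ne inj_z z0 nz sz]
    by (simp add: hypoxg_A1_def hypoxg_A2_def hypoxg_A3_def z_def)
qed

theorem theorem2p2:
  fixes M :: "'a measure" and S :: "'a \<Rightarrow> real"
    and N :: "nat \<Rightarrow> nat \<Rightarrow> 'b measure" and Y :: "nat \<Rightarrow> nat \<Rightarrow> 'b \<Rightarrow> real"
    and \<theta> :: "nat \<Rightarrow> real" and n :: nat and t :: real
  assumes "n \<ge> 1"
    and "\<And>i. i \<in> {1..n} \<Longrightarrow> \<theta> i > 0"
    and "inj_on \<theta> {1..n}"
    and "prob_space M"
    and "HypoXG_distributed M S n \<theta>"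
    and "\<And>i k. i \<in> {1..n} \<Longrightarrow> k \<in> {1..3} \<Longrightarrow> prob_space (N i k)"
    and "\<And>i k. i \<in> {1..n} \<Longrightarrow> k \<in> {1..3} \<Longrightarrow> Erl_distributed (N i k) (Y i k) (4 - k) (\<theta> i)"
  shows "cdf (distr M borel S) t =
    (\<Sum>i\<in>{1..n}. \<Sum>k\<in>{1..3}. hypoxg_R n \<theta> i k * cdf (distr (N i k) borel (Y i k)) t)"
proof -
  interpret prob_space M by fact
  from assms(5) obtain X where indep: "indep_vars (\<lambda>_. borel) X {1..n}"
    and X: "\<And>j. j \<in> {1..n} \<Longrightarrow> XG_distributed M (X j) (\<theta> j)"
    and S: "\<And>\<omega>. \<omega> \<in> space M \<Longrightarrow> S \<omega> = (\<Sum>j\<in>{1..n}. X j \<omega>)"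
    unfolding HypoXG_distributed_def by blast
  have rvX: "random_variable borel (X j)" if "j \<in> {1..n}" for j
    using indep that by (simp add: indep_vars_def)
  have S_distr: "distr M borel S = distr M borel (\<lambda>\<omega>. \<Sum>j\<in>{1..n}. X j \<omega>)"
    by (rule distr_cong) (auto simp: S)
  \<comment> \<open>The double sum is indexed by pairs, to fit the single finite index set of
    \<open>cdf_eq_sum_if_char_eq_sum\<close>.\<close>
  let ?I = "{1..n} \<times> {1..3::nat}"
  let ?\<nu> = "\<lambda>(i, k). distr (N i k) borel (Y i k)"
  let ?R = "\<lambda>(i, k). hypoxg_R n \<theta> i k"
  define C where "C = (\<Prod>l\<in>{1..n}. (\<theta> l)\<^sup>2 / (1 + \<theta> l))"
  have "cdf (distr M borel S) t = (\<Sum>p\<in>?I. ?R p * cdf (?\<nu> p) t)"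
  proof (rule cdf_eq_sum_if_char_eq_sum)
    show "real_distribution (distr M borel S)"
      unfolding S_distr using rvX by (intro real_distribution_distr borel_measurable_sum) auto
    show "real_distribution (?\<nu> p)" if mem: "p \<in> ?I" for p
    proof -
      obtain i k where p: "p = (i, k)" "i \<in> {1..n}" "k \<in> {1..3}" using mem by (cases p) auto
      interpret P: prob_space "N i k" using assms(6) p by blast
      have "Y i k \<in> measurable (N i k) lborel"
        using assms(7)[OF p(2,3)] by (auto simp: Erl_distributed_def distributed_def)
      then show ?thesis using p by (simp add: measurable_lborel1)
    qed
    show "char (distr M borel S) u = (\<Sum>p\<in>?I. ?R p * char (?\<nu> p) u)" for u
    proof -
      \<comment> \<open>The divisor \<open>\<theta> i ^ (4 - k)\<close> in \<open>hypoxg_R\<close>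
        cancels the numerator of the Erlang characteristic function.\<close>
      have summand: "hypoxg_R n \<theta> i k * char (?\<nu> (i, k)) u
        = C * (hypoxg_A n \<theta> i k / (\<theta> i - \<i> * u) ^ (4 - k))"
        if "i \<in> {1..n}" "k \<in> {1..3}" for i k
      proof -
        have cancel: "complex_of_real (a / b * c) * (complex_of_real b / w) = c * (a / w)"
          if "b \<noteq> 0" for a b c :: real and w :: complex
          using that by simp
        have "char (?\<nu> (i, k)) u = of_real (\<theta> i ^ (4 - k)) / (\<theta> i - \<i> * u) ^ (4 - k)"
          unfolding case_prod_conv char_Erl_distributed[OF assms(7)[OF that]]
          by (simp only: power_divide of_real_power)
        then show ?thesis
          unfolding hypoxg_R_def C_def[symmetric] using assms(2)[OF that(1)]
          by (simp only: cancel power_not_zero less_imp_neq[symmetric] not_False_eq_True)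
      qed
      \<comment> \<open>The expansion is evaluated at \<open>s = - \<i> * u\<close>; every
        \<open>s + \<theta> i\<close> has positive real part.\<close>
      have s: "- (\<i> * complex_of_real u) + complex_of_real (\<theta> i) \<noteq> 0" if "i \<in> {1..n}" for i
        using assms(2)[OF that] by (auto simp: complex_eq_iff)
      have sum_3: "(\<Sum>k\<in>{1..3}. f k) = f 1 + f 2 + f 3" for f :: "nat \<Rightarrow> complex"
        by (simp add: numeral_3_eq_3 numeral_2_eq_2)
      have "char (distr M borel S) u = (\<Prod>j\<in>{1..n}. char (distr M borel (X j)) u)"
        unfolding S_distr by (rule char_distr_sum[OF indep])
      also have "\<dots> = C * (\<Prod>j\<in>{1..n}. ((\<theta> j - \<i> * u)\<^sup>2 + \<theta> j) / (\<theta> j - \<i> * u) ^ 3)"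
        unfolding C_def of_real_prod prod.distrib[symmetric]
        by (intro prod.cong refl char_XG_distributed X)
      also have "(\<Prod>j\<in>{1..n}. ((\<theta> j - \<i> * u)\<^sup>2 + \<theta> j) / (\<theta> j - \<i> * u) ^ 3) =
        (\<Sum>i\<in>{1..n}. hypoxg_A1 n \<theta> i / (\<theta> i - \<i> * u) ^ 3 + hypoxg_A2 n \<theta> i / (\<theta> i - \<i> * u)\<^sup>2
          + hypoxg_A3 n \<theta> i / (\<theta> i - \<i> * u))"
        using hypoxg_partial_fractions[OF assms(1-3) s] by (simp only: uminus_add_conv_diff)
      also have "\<dots> = (\<Sum>i\<in>{1..n}. \<Sum>k\<in>{1..3}. hypoxg_A n \<theta> i k / (\<theta> i - \<i> * u) ^ (4 - k))"
        unfolding sum_3 by (intro sum.cong refl) (simp add: hypoxg_A_def)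
      also have "C * \<dots> = (\<Sum>i\<in>{1..n}. \<Sum>k\<in>{1..3}. C * (hypoxg_A n \<theta> i k / (\<theta> i - \<i> * u) ^ (4 - k)))"
        by (simp only: sum_distrib_left)
      also have "\<dots> = (\<Sum>i\<in>{1..n}. \<Sum>k\<in>{1..3}. hypoxg_R n \<theta> i k * char (?\<nu> (i, k)) u)"
        by (intro sum.cong refl summand[symmetric])
      finally show ?thesis by (simp add: sum.cartesian_product split_def)
    qed
  qed simp
  then show ?thesis by (simp add: sum.cartesian_product split_def)
qed

end
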